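(* Let $G$ be an $n \times n$ bipartite graph (with $n \geq 1$). Then \[ \beta(G) \geq \left\lfloor \frac{1}{2} \cdot \sum_{v \in V(G)} \frac{1}{d(v)+1} \right\rfloor, \] where $d(v)$ denotes the degree of $v$ in $G$.
   Context: An $n \times n$ bipartite graph is a bipartite graph $G=(A,B,E)$ with a fixed bipartition into parts $A$ and $B$ satisfying $|A|=|B|=n$. A bi-hole of size $t$ in $G$ is a pair of sets $X \subseteq A$, $Y \subseteq B$ with $|X|=|Y|=t$ such that there is no edge of $G$ between any vertex of $X$ and any vertex of $Y$ (i.e., a copy of $K_{t,t}$ in the bipartite complement of $G$). $\beta(G)$ denotes the largest $k$ for which $G$ has a bi-hole of size $k$. *)

theory Defs
  imports Complex_Main
begin

definition bipartite_nn :: "nat \<Rightarrow> 'a set \<Rightarrow> 'a set \<Rightarrow> 'a set set \<Rightarrow> bool" where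
  "bipartite_nn n A B E \<longleftrightarrow>
     finite A \<and> finite B \<and> A \<inter> B = {} \<and> card A = n \<and> card B = n \<and>
     E \<subseteq> {{a, b} | a b. a \<in> A \<and> b \<in> B}"

definition vertex_degree :: "'a set set \<Rightarrow> 'a \<Rightarrow> nat" where
  "vertex_degree E v = card {e \<in> E. v \<in> e}"

definition bi_hole :: "'a set \<Rightarrow> 'a set \<Rightarrow> 'a set set \<Rightarrow> nat \<Rightarrow> 'a set \<Rightarrow> 'a set \<Rightarrow> bool" where
  "bi_hole A B E t X Y \<longleftrightarrow>
     X \<subseteq> A \<and> Y \<subseteq> B \<and> card X = t \<and> card Y = t \<and> (\<forall>x\<in>X. \<forall>y\<in>Y. {x, y} \<notin> E)"

definition bi_hole_number :: "'a set \<Rightarrow> 'a set \<Rightarrow> 'a set set \<Rightarrow> nat" where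
  "bi_hole_number A B E = Max {k. \<exists>X Y. bi_hole A B E k X Y}"

text \<open>The maximum is taken over a nonempty finite set, so it is attained.\<close>

lemma bi_hole_sizes_nonempty: "{k. \<exists>X Y. bi_hole A B E k X Y} \<noteq> {}"
proof -
  have "bi_hole A B E 0 {} {}" by (simp add: bi_hole_def)
  then show ?thesis by blast
qed

lemma bi_hole_sizes_finite:
  assumes "finite A"
  shows "finite {k. \<exists>X Y. bi_hole A B E k X Y}"
proof (rule finite_subset)
  show "{k. \<exists>X Y. bi_hole A B E k X Y} \<subseteq> {..card A}"
    using assms by (auto simp: bi_hole_def intro: card_mono)
qed simp

end

theory Submission
  imports Defs
begin

text \<open>
  Some side, say \<open>A\<close>, satisfies \<open>\<Sum>a\<in>A. 1/(d(a)+1) \<ge> t\<close>, where \<open>t\<close> is the claimed bound.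
  Let \<open>X\<close> consist of \<open>t\<close> vertices of smallest degree in \<open>A\<close>. Weighting each \<open>a \<in> A\<close> by
  \<open>1/(d(a)+1)\<close> is a fractional choice of at least \<open>t\<close> vertices with total degree
  \<open>n - \<Sum>a\<in>A. 1/(d(a)+1) \<le> n - t\<close>, so the degrees in \<open>X\<close> add up to at most \<open>n - t\<close>,
  and at least \<open>t\<close> vertices of \<open>B\<close> have no neighbour in \<open>X\<close>.
\<close>

text \<open>Greedy choice: add a minimiser of \<open>f\<close> on \<open>A - X\<close> and let its
  value be the new threshold. The threshold \<open>c\<close> records that \<open>X\<close> collects
  smallest values.\<close>

lemma exists_smallest_subset:
  fixes f :: "'a \<Rightarrow> nat"
  assumes "finite A" "t \<le> card A"
  shows "\<exists>X c. X \<subseteq> A \<and> card X = t \<and> (\<forall>a\<in>X. f a \<le> c) \<and> (\<forall>a\<in>A - X. c \<le> f a)"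
  using assms(2)
proof (induction t)
  case 0
  show ?case by (intro exI[of _ "{}"] exI[of _ 0]) simp
next
  case (Suc t)
  then obtain X c where X: "X \<subseteq> A" "card X = t" "\<forall>a\<in>X. f a \<le> c" "\<forall>a\<in>A - X. c \<le> f a"
    by auto
  have "A - X \<noteq> {}"
    using X(1,2) Suc.prems by auto
  then obtain a where a: "a \<in> A - X" "\<forall>b\<in>A - X. f a \<le> f b"
    using ex_has_least_nat[of "\<lambda>a. a \<in> A - X" _ f] by blast
  have "finite X"
    using X(1) assms(1) finite_subset by blast
  with X a have "insert a X \<subseteq> A" "card (insert a X) = Suc t"
    by auto
  moreover have "\<forall>b\<in>insert a X. f b \<le> f a"
    using X(3,4) a(1) by (auto intro: order_trans)
  ultimately show ?case
    using a(2) by blast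
qed

text \<open>Put w(a) = 1/(d(a)+1), so w(a)(d(a)+1) = 1. Replacing the weights w by the indicator of
  \<open>X\<close> adds 1 - w(a) on \<open>X\<close>, at cost at most c+1 per unit, and removes w(a)
  outside, saving at least c+1 per unit. The total weight does not grow, so neither does the cost,
  which was \<open>card A\<close>.\<close>

lemma sum_smallest_le_card:
  fixes d :: "'a \<Rightarrow> nat"
  assumes "finite A" and "X \<subseteq> A"
    and small: "\<And>a. a \<in> X \<Longrightarrow> d a \<le> c"
    and large: "\<And>a. a \<in> A - X \<Longrightarrow> c \<le> d a"
    and weight: "real (card X) \<le> (\<Sum>a\<in>A. 1 / (real (d a) + 1))"
  shows "(\<Sum>a\<in>X. d a) + card X \<le> card A"
proof -
  have split: "sum h A = sum h X + sum h (A - X)" for h :: "'a \<Rightarrow> real"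
    using assms(1,2) by (metis add.commute sum.subset_diff)
  \<comment> \<open>On \<open>X\<close>, d(a) = (d(a)+1)(1 - w(a)) is the added cost.\<close>
  have "(\<Sum>a\<in>X. real (d a)) \<le> (\<Sum>a\<in>X. (real c + 1) * (1 - 1 / (real (d a) + 1)))"
  proof (rule sum_mono)
    fix a assume "a \<in> X"
    then have "real (d a) * (real (d a) + 1) \<le> real (d a) * (real c + 1)"
      using small by (intro mult_left_mono) auto
    then show "real (d a) \<le> (real c + 1) * (1 - 1 / (real (d a) + 1))"
      by (simp add: field_simps)
  qed
  moreover have "(\<Sum>a\<in>A - X. (real c + 1) * (1 / (real (d a) + 1))) \<le> (\<Sum>a\<in>A - X. 1)"
    using large by (intro sum_mono) (auto simp: field_simps)
  ultimately have "(\<Sum>a\<in>X. real (d a)) - (\<Sum>a\<in>A - X. 1)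
      \<le> (\<Sum>a\<in>X. (real c + 1) * (1 - 1 / (real (d a) + 1)))
        - (\<Sum>a\<in>A - X. (real c + 1) * (1 / (real (d a) + 1)))"
    by linarith
  also have "\<dots> = (real c + 1) * (real (card X) - (\<Sum>a\<in>A. 1 / (real (d a) + 1)))"
    unfolding sum_distrib_left[symmetric] sum_subtractf split[of "\<lambda>a. 1 / (real (d a) + 1)"]
    by (simp only: right_diff_distrib distrib_left sum_constant mult_1_right diff_diff_eq)
  also have "\<dots> \<le> 0"
    using weight by (intro mult_nonneg_nonpos) auto
  finally have "(\<Sum>a\<in>X. real (d a)) + real (card X) \<le> real (card A)"
    using split[of "\<lambda>_. 1"] by simp
  then have "real ((\<Sum>a\<in>X. d a) + card X) \<le> real (card A)"
    by simp
  then show ?thesis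
    by linarith
qed

lemma card_neighbours_le_vertex_degree:
  assumes "finite E"
  shows "card {b \<in> B. {a, b} \<in> E} \<le> vertex_degree E a"
  unfolding vertex_degree_def
proof (rule card_inj_on_le)
  show "inj_on (\<lambda>b. {a, b}) {b \<in> B. {a, b} \<in> E}"
    by (auto simp: inj_on_def doubleton_eq_iff)
qed (use assms in auto)

text \<open>Only the weight of one side enters, so this also applies with \<open>A\<close> and
  \<open>B\<close> exchanged.\<close>

lemma bi_hole_of_side_weight:
  assumes "finite A" "finite B" "finite E" "card A = card B"
    and weight: "real t \<le> (\<Sum>a\<in>A. 1 / (real (vertex_degree E a) + 1))"
  shows "\<exists>X Y. bi_hole A B E t X Y"
proof -
  \<comment> \<open>Each weight is at most 1, hence \<open>A\<close> has at least \<open>t\<close>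
    vertices to choose from.\<close>
  have "(\<Sum>a\<in>A. 1 / (real (vertex_degree E a) + 1)) \<le> (\<Sum>a\<in>A. 1)"
    by (intro sum_mono) (simp add: field_simps)
  also have "\<dots> = real (card A)"
    by simp
  finally have "t \<le> card A"
    using weight by linarith
  then obtain X c where X: "X \<subseteq> A" "card X = t"
      "\<forall>a\<in>X. vertex_degree E a \<le> c" "\<forall>a\<in>A - X. c \<le> vertex_degree E a"
    using exists_smallest_subset[OF assms(1), of t "vertex_degree E"] by auto
  have "finite X"
    using X(1) assms(1) finite_subset by blast
  define N where "N = (\<Union>a\<in>X. {b \<in> B. {a, b} \<in> E})"
  have "card N \<le> (\<Sum>a\<in>X. card {b \<in> B. {a, b} \<in> E})"
    unfolding N_def by (rule card_UN_le[OF \<open>finite X\<close>])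
  also have "\<dots> \<le> (\<Sum>a\<in>X. vertex_degree E a)"
    by (intro sum_mono card_neighbours_le_vertex_degree assms(3))
  \<comment> \<open>The bound obtained in \<open>A\<close> passes to \<open>B\<close> because the
    sides have equal size.\<close>
  finally have "card N + t \<le> card B"
    using sum_smallest_le_card[of A X "vertex_degree E" c] X assms(1,4) weight by auto
  moreover have "card (B - N) = card B - card N"
    using assms(2) by (intro card_Diff_subset) (auto simp: N_def intro: finite_subset)
  ultimately have "t \<le> card (B - N)"
    by linarith
  then obtain Y where "Y \<subseteq> B - N" "card Y = t"
    by (rule obtain_subset_with_card_n)
  with X have "bi_hole A B E t X Y"
    unfolding bi_hole_def N_def by auto
  then show ?thesis
    by blast
qed

lemma bi_hole_swap: "bi_hole A B E t X Y \<longleftrightarrow> bi_hole B A E t Y X"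
  unfolding bi_hole_def by (metis insert_commute)

theorem theorem2:
  fixes A B :: "'a set" and E :: "'a set set" and n :: nat
  assumes "n \<ge> 1"
    and "bipartite_nn n A B E"
  shows "int (bi_hole_number A B E) \<ge>
    \<lfloor>(1 / 2) * (\<Sum>v \<in> A \<union> B. 1 / (real (vertex_degree E v) + 1))\<rfloor>"
proof -
  let ?w = "\<lambda>V. \<Sum>v\<in>V. 1 / (real (vertex_degree E v) + 1)"
  have fin: "finite A" "finite B" "card A = card B" and "A \<inter> B = {}"
    and E: "E \<subseteq> {{a, b} | a b. a \<in> A \<and> b \<in> B}"
    using assms(2) by (auto simp: bipartite_nn_def)
  have "E \<subseteq> Pow (A \<union> B)"
    using E by auto
  then have "finite E"
    using fin by (meson finite_Pow_iff finite_Un finite_subset)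
  have nonneg: "0 \<le> ?w V" for V
    by (intro sum_nonneg) simp
  define t where "t = nat \<lfloor>(1 / 2) * ?w (A \<union> B)\<rfloor>"
  have "real t \<le> (1 / 2) * ?w (A \<union> B)"
    using nonneg[of "A \<union> B"] unfolding t_def by (intro of_nat_floor) simp
  also have "?w (A \<union> B) = ?w A + ?w B"
    using fin \<open>A \<inter> B = {}\<close> by (intro sum.union_disjoint)
  \<comment> \<open>The larger of the two side weights is at least their average.\<close>
  finally have "real t \<le> ?w A \<or> real t \<le> ?w B"
    by (simp add: field_simps) linarith
  then consider "real t \<le> ?w A" | "real t \<le> ?w B"
    by blast
  then have "\<exists>X Y. bi_hole A B E t X Y"
  proof cases
    case 1
    then show ?thesis
      using bi_hole_of_side_weight fin \<open>finite E\<close> by blast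
  next
    case 2
    then have "\<exists>Y X. bi_hole B A E t Y X"
      using bi_hole_of_side_weight fin \<open>finite E\<close> by metis
    then show ?thesis
      using bi_hole_swap by blast
  qed
  then have "t \<le> bi_hole_number A B E"
    unfolding bi_hole_number_def
    by (intro Max_ge bi_hole_sizes_finite fin) simp
  then show ?thesis
    unfolding t_def by linarith
qed

end
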